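(* Let $n \geq 2$ be an integer, and let $M$ be the regularity matrix of $FJ(n,1)$, i.e. the real $n \times n$ tridiagonal matrix with $M_{1,1} = M_{n,n} = n-2$, $M_{i,i} = n-3$ for $1<i<n$, $M_{i,j} = 1$ for $|i-j|=1$, and $M_{i,j}=0$ for $|i-j|>1$. Then the set of eigenvalues of $M$ is a subset of the set of eigenvalues of (the adjacency matrix of) the Full-Flag Johnson graph $FJ(n,1)$, not considering multiplicity.
   Context: For a permutation $u=(u_1,\ldots,u_n)$ of $(1,2,\ldots,n)$ and $i \in [n]=\{1,\ldots,n\}$ write $u(i) = \{u_1, u_2, \ldots, u_i\}$. For integers $0 \leq k < n$, the Full-Flag Johnson graph $FJ(n,k)$ has as vertex set all permutations of $(1,\ldots,n)$; two vertices $u,v$ are adjacent if and only if $u(i) \neq v(i)$ for exactly $k$ integers $i \in [n]$. In particular, $FJ(n,1)$ is the order-$n$ permutahedron (two permutations are adjacent if and only if one is obtained from the other by interchanging the entries in two consecutive positions). The eigenvalue spectrum of a graph is that of its adjacency matrix, which does not depend on the vertex ordering. *)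

theory Defs
  imports
    "HOL-Combinatorics.Multiset_Permutations"
    "Graph_Theory.Pair_Digraph"
    "Jordan_Normal_Form.Spectral_Radius"
begin

text \<open>
  A permutation \<open>u = (u\<^sub>1, \<dots>, u\<^sub>n)\<close> of \<open>(1, \<dots>, n)\<close> is represented by the list of its entries, so the
  set \<open>u(i) = {u\<^sub>1, \<dots>, u\<^sub>i}\<close> is the set of the first \<open>i\<close> entries of the list.
\<close>

definition flag :: "nat list \<Rightarrow> nat \<Rightarrow> nat set" where
  "flag u i = set (take i u)"

text \<open>
  Undirected graphs are represented by symmetric digraphs: every edge gives two opposite arcs.
  For \<open>k = 0\<close> the adjacency condition is satisfied exactly by \<open>u = v\<close>, so the only edges are loops.
\<close>

definition FJ :: "nat \<Rightarrow> nat \<Rightarrow> nat list pair_pre_digraph" where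
  "FJ n k = \<lparr> pverts = permutations_of_set {1..n},
     parcs = {(u, v). u \<in> permutations_of_set {1..n} \<and> v \<in> permutations_of_set {1..n} \<and>
       card {i \<in> {1..n}. flag u i \<noteq> flag v i} = k} \<rparr>"

text \<open>
  The list \<open>vs\<close> is an ordering of the vertices, i.e. it is distinct and its set is \<open>pverts G\<close>.
\<close>

definition adjacency_matrix :: "'v pair_pre_digraph \<Rightarrow> 'v list \<Rightarrow> real mat" where
  "adjacency_matrix G vs = mat (length vs) (length vs)
     (\<lambda>(i, j). if (vs ! i, vs ! j) \<in> parcs G then 1 else 0)"

text \<open>
  Matrix indices start at \<open>0\<close>, so the corner entries \<open>M\<^sub>1\<^sub>,\<^sub>1\<close> and \<open>M\<^sub>n\<^sub>,\<^sub>n\<close> are those at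
  \<open>(0, 0)\<close> and \<open>(n - 1, n - 1)\<close>.
\<close>

definition regularity_matrix :: "nat \<Rightarrow> real mat" where
  "regularity_matrix n = mat n n (\<lambda>(i, j).
     if i = j then (if i = 0 \<or> i = n - 1 then real n - 2 else real n - 3)
     else if \<bar>int i - int j\<bar> = 1 then 1 else 0)"

end

theory Submission
  imports Defs
begin

text \<open>
  The neighbours of \<open>u\<close> in \<open>FJ(n,1)\<close> are the \<open>n - 1\<close> lists obtained from \<open>u\<close> by an adjacent swap.
  Sorting the vertices by the position of the entry \<open>1\<close> is therefore an equitable partition whose
  quotient matrix is the regularity matrix \<open>M\<close>, and an eigenvector \<open>x\<close> of \<open>M\<close> lifts to the
  eigenvector \<open>u \<mapsto> x\<^sub>p\<close> of the graph, where \<open>p\<close> is the position of \<open>1\<close> in \<open>u\<close>.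
\<close>

section \<open>Adjacent swaps and the flags they change\<close>

definition adj_swap :: "nat \<Rightarrow> 'a list \<Rightarrow> 'a list" where
  "adj_swap i u = u[i := u ! Suc i, Suc i := u ! i]"

lemma length_adj_swap [simp]: "length (adj_swap i u) = length u"
  by (simp add: adj_swap_def)

lemma set_adj_swap [simp]: "Suc i < length u \<Longrightarrow> set (adj_swap i u) = set u"
  by (simp add: adj_swap_def)

lemma distinct_adj_swap [simp]: "Suc i < length u \<Longrightarrow> distinct (adj_swap i u) = distinct u"
  by (simp add: adj_swap_def)

lemma nth_adj_swap:
  assumes "Suc i < length u" "j < length u"
  shows "adj_swap i u ! j = u ! transpose i (Suc i) j"
  using assms by (auto simp: adj_swap_def nth_list_update transpose_def)

text \<open>A prefix that contains neither or both of the swapped positions keeps its set of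
  entries; only the prefix of length \<open>Suc i\<close> contains exactly one of them.\<close>

lemma flag_adj_swap_eq_iff:
  assumes "distinct u" "Suc i < length u"
  shows "flag (adj_swap i u) j = flag u j \<longleftrightarrow> j \<noteq> Suc i"
proof -
  consider "j \<le> i" | "j = Suc i" | "Suc i < j" by linarith
  then show ?thesis
  proof cases
    case 1
    then show ?thesis by (simp add: flag_def adj_swap_def)
  next
    case 2
    \<comment> \<open>The entry \<open>u ! i\<close> separates the two flags: the swap moves it just
      past the prefix.\<close>
    have "u ! i \<in> flag u j"
      using assms 2 by (simp add: flag_def take_Suc_conv_app_nth)
    moreover have "u ! i \<notin> flag (adj_swap i u) j"
    proof
      assume "u ! i \<in> flag (adj_swap i u) j"
      then obtain m where m: "m < Suc i" "adj_swap i u ! m = u ! i"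
        using assms 2 by (auto simp: flag_def in_set_conv_nth)
      then have "u ! transpose i (Suc i) m = u ! i"
        using assms by (simp add: nth_adj_swap)
      moreover have "transpose i (Suc i) m < length u" "transpose i (Suc i) m \<noteq> i"
        using m assms by (auto simp: transpose_def)
      ultimately show False
        using assms by (simp add: nth_eq_iff_index_eq)
    qed
    ultimately show ?thesis using 2 by blast
  next
    case 3
    have "take j (adj_swap i u) = adj_swap i (take j u)"
      using 3 by (simp add: adj_swap_def take_update_swap)
    then show ?thesis using 3 assms by (simp add: flag_def)
  qed
qed

text \<open>The swap index can be read off as the place of the only changed flag. This lets a sum
  over neighbours be reindexed by swaps.\<close>

lemma inj_on_adj_swap:
  fixes u :: "nat list"
  assumes "distinct u" "length u = n"
  shows "inj_on (\<lambda>i. adj_swap i u) {..<n - 1}"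
proof (rule inj_onI)
  fix i j assume *: "i \<in> {..<n - 1}" "j \<in> {..<n - 1}" "adj_swap i u = adj_swap j u"
  then have "Suc i < length u" "Suc j < length u" using assms(2) by auto
  from flag_adj_swap_eq_iff[OF assms(1) this(1), of "Suc j"]
    flag_adj_swap_eq_iff[OF assms(1) this(2), of "Suc j"]
  show "i = j" unfolding *(3) by blast
qed

section \<open>Reconstruction from flags, and the neighbours in FJ(n,1)\<close>

lemma flag_Suc: "i < length u \<Longrightarrow> flag u (Suc i) = insert (u ! i) (flag u i)"
  by (simp add: flag_def take_Suc_conv_app_nth)

lemma nth_notin_flag:
  assumes "distinct u" "i < length u" "j \<le> i"
  shows "u ! i \<notin> flag u j"
  using assms by (auto simp: flag_def in_set_conv_nth nth_eq_iff_index_eq)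

lemma nth_eq_if_flag_eq:
  assumes "distinct u" "distinct v" "i < length u" "i < length v"
    and "flag u i = flag v i" "flag u (Suc i) = flag v (Suc i)"
  shows "u ! i = v ! i"
proof -
  have "insert (u ! i) (flag v i) = insert (v ! i) (flag v i)"
    using assms(6) unfolding flag_Suc[OF assms(3)] flag_Suc[OF assms(4)] assms(5) .
  moreover have "u ! i \<notin> flag v i"
    using nth_notin_flag[OF assms(1,3) order.refl] unfolding assms(5) .
  ultimately show ?thesis by blast
qed

text \<open>Two consecutive flags determine an entry, so the lists agree away from the positions
  \<open>d - 1\<close> and \<open>d\<close>. There the agreeing flags \<open>d - 1\<close> and
  \<open>d + 1\<close> force the same pair of entries, and the differing flag \<open>d\<close>
  forces the opposite order.\<close>

lemma eq_adj_swap_if_flags_differ_once: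
  assumes "distinct u" "distinct v" "length u = length v" "set u = set v"
    and D: "{i \<in> {1..length u}. flag u i \<noteq> flag v i} = {d}"
  shows "Suc (d - 1) < length u" "v = adj_swap (d - 1) u"
proof -
  have d: "1 \<le> d" "d \<le> length u" "flag u d \<noteq> flag v d" using D by auto
  have eq: "flag u j = flag v j" if "j \<noteq> d" "j \<le> length u" for j
  proof (cases "j = 0")
    case False
    have "j \<notin> {i \<in> {1..length u}. flag u i \<noteq> flag v i}"
      unfolding D using that by simp
    then show ?thesis using False that by simp
  qed (simp add: flag_def)
  \<comment> \<open>The last flag is the whole entry set, which both lists share; hence position
    \<open>d\<close> exists.\<close>
  have "d \<noteq> length u" using d assms(3,4) by (auto simp: flag_def)
  with d have lt: "d < length u" by simp
  then show "Suc (d - 1) < length u" using d by simp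
  obtain e where e: "d = Suc e" using d by (cases d) auto
  have feq: "flag u e = flag v e" "flag u (Suc (Suc e)) = flag v (Suc (Suc e))"
    by (rule eq; use lt in \<open>simp add: e\<close>)+
  have lts: "e < length u" "e < length v" "Suc e < length u" "Suc e < length v"
    using lt assms(3) unfolding e by simp_all
  have ne: "u ! e \<noteq> v ! e"
    using d(3) unfolding e flag_Suc[OF lts(1)] flag_Suc[OF lts(2)] feq(1) by metis
  from feq(2) have ins: "insert (u ! Suc e) (insert (u ! e) (flag v e))
      = insert (v ! Suc e) (insert (v ! e) (flag v e))"
    unfolding flag_Suc[OF lts(3)] flag_Suc[OF lts(4)] flag_Suc[OF lts(1)] flag_Suc[OF lts(2)]
      feq(1) .
  have notin: "u ! e \<notin> flag v e" "u ! Suc e \<notin> flag v e" "v ! e \<notin> flag v e" "v ! Suc e \<notin> flag v e"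
    using nth_notin_flag[OF assms(1), of _ e] nth_notin_flag[OF assms(2), of _ e] lts
    unfolding feq(1) by simp_all
  \<comment> \<open>Cancelling the common flag leaves two equal pairs whose members at
    \<open>e\<close> differ, so they are crossed.\<close>
  have sw: "v ! e = u ! Suc e" "v ! Suc e = u ! e"
    using ins notin ne by (metis insert_iff)+
  have "v = adj_swap e u"
  proof (rule nth_equalityI)
    fix j assume j: "j < length v"
    show "v ! j = adj_swap e u ! j"
    proof (cases "j = e \<or> j = Suc e")
      case True
      then show ?thesis using sw lts by (auto simp: nth_adj_swap)
    next
      case False
      \<comment> \<open>Neither \<open>j\<close> nor \<open>Suc j\<close> equals
        \<open>d = Suc e\<close>, so both flags around entry \<open>j\<close> agree.\<close>
      then have "u ! j = v ! j"
        using j assms(1-3) by (intro nth_eq_if_flag_eq eq) (simp_all add: e)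
      then show ?thesis
        using False j assms(3) lts by (simp add: nth_adj_swap transpose_def)
    qed
  qed (simp add: assms)
  then show "v = adj_swap (d - 1) u" by (simp add: e)
qed

lemma permutations_of_set_Icc_1D:
  assumes "u \<in> permutations_of_set {1..n::nat}"
  shows "distinct u" "set u = {1..n}" "length u = n"
  using assms length_finite_permutations_of_set[OF assms]
  by (simp_all add: permutations_of_set_def)

lemma neighbours_FJ_1:
  assumes "u \<in> permutations_of_set {1..n}"
  shows "{v. (u, v) \<in> parcs (FJ n 1)} = (\<lambda>i. adj_swap i u) ` {..<n - 1}"
proof -
  note u = permutations_of_set_Icc_1D[OF assms]
  show ?thesis
  proof (intro equalityI subsetI)
    fix v assume "v \<in> {v. (u, v) \<in> parcs (FJ n 1)}"
    then have v: "distinct v" "set v = {1..n}"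
      and "card {i \<in> {1..n}. flag u i \<noteq> flag v i} = 1"
      by (auto simp: FJ_def permutations_of_set_def)
    then obtain d where d: "{i \<in> {1..length u}. flag u i \<noteq> flag v i} = {d}"
      unfolding u(3) by (meson card_1_singletonE)
    have "length u = length v" "set u = set v"
      using u v by (metis distinct_card)+
    from eq_adj_swap_if_flags_differ_once[OF u(1) v(1) this d]
    show "v \<in> (\<lambda>i. adj_swap i u) ` {..<n - 1}"
      unfolding u(3) by (intro image_eqI[where x = "d - 1"]) (simp, simp)
  next
    fix v assume "v \<in> (\<lambda>i. adj_swap i u) ` {..<n - 1}"
    then obtain i where i: "Suc i < n" "v = adj_swap i u" by force
    have "flag u j \<noteq> flag v j \<longleftrightarrow> j = Suc i" for j
      using flag_adj_swap_eq_iff[of u i j] i u by auto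
    then have "{j \<in> {1..n}. flag u j \<noteq> flag v j} = {Suc i}"
      using i(1) by auto
    moreover have "v \<in> permutations_of_set {1..n}"
      using i u by (simp add: permutations_of_set_def)
    ultimately show "v \<in> {v. (u, v) \<in> parcs (FJ n 1)}"
      using assms by (simp add: FJ_def)
  qed
qed

section \<open>The position of an entry, and matrix rows as sums over swaps\<close>

definition position :: "'a \<Rightarrow> 'a list \<Rightarrow> nat" where
  "position a u = (THE p. p < length u \<and> u ! p = a)"

lemma position_eqI:
  assumes "distinct u" "p < length u" "u ! p = a"
  shows "position a u = p"
  unfolding position_def
proof (rule the_equality)
  fix q assume "q < length u \<and> u ! q = a"
  then show "q = p" using assms nth_eq_iff_index_eq by blast
qed (use assms in simp)

lemma position:
  assumes "distinct u" "a \<in> set u"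
  shows "position a u < length u" "u ! position a u = a"
proof -
  obtain p where p: "p < length u" "u ! p = a" using assms(2) by (auto simp: in_set_conv_nth)
  then have "position a u = p" by (rule position_eqI[OF assms(1)])
  then show "position a u < length u" "u ! position a u = a" using p by simp_all
qed

text \<open>A transposition is its own inverse. The new position depends on \<open>u\<close> only
  through the old one, which makes the partition equitable.\<close>

lemma position_adj_swap:
  assumes "distinct u" "a \<in> set u" "Suc i < length u"
  shows "position a (adj_swap i u) = transpose i (Suc i) (position a u)"
proof (rule position_eqI)
  show "transpose i (Suc i) (position a u) < length (adj_swap i u)"
    using assms position[of u a] by (auto simp: transpose_def)
  then show "adj_swap i u ! transpose i (Suc i) (position a u) = a"
    using assms position[of u a] by (simp add: nth_adj_swap)
qed (use assms in simp)

text \<open>Of the \<open>n - 1\<close> swaps, one moves \<open>p\<close> if it is an end and two if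
  it is interior, each to an adjacent position; the remaining \<open>n - 2\<close> or
  \<open>n - 3\<close> fix \<open>p\<close> and give the diagonal entry.\<close>

lemma regularity_matrix_mult_vec:
  assumes "2 \<le> n" "x \<in> carrier_vec n" "p < n"
  shows "(regularity_matrix n *\<^sub>v x) $ p = (\<Sum>i<n - 1. x $ transpose i (Suc i) p)"
proof -
  define c where "c = (if p = 0 \<or> p = n - 1 then real n - 2 else real n - 3)"
  have "(regularity_matrix n *\<^sub>v x) $ p = (\<Sum>j<n. regularity_matrix n $$ (p, j) * x $ j)"
    using assms by (auto simp: regularity_matrix_def scalar_prod_def lessThan_atLeast0 intro!: sum.cong)
  \<comment> \<open>The guard \<open>0 < p\<close> is there because \<open>p - 1\<close> truncates
    to \<open>0\<close> at \<open>p = 0\<close>.\<close>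
  also have "\<dots> = (\<Sum>j<n. (if j = p then c * x $ p else 0)
      + (if j = Suc p then x $ Suc p else 0) + (if j = p - 1 \<and> 0 < p then x $ (p - 1) else 0))"
    using assms by (intro sum.cong) (auto simp: regularity_matrix_def c_def)
  also have "\<dots> = c * x $ p + (if Suc p < n then x $ Suc p else 0)
      + (if 0 < p then x $ (p - 1) else 0)"
    using assms by (cases "0 < p") (auto simp: sum.distrib)
  \<comment> \<open>The coefficient \<open>c\<close> is \<open>n - 1\<close> minus the number of
    positions adjacent to \<open>p\<close>, so each adjacent position contributes a
    difference.\<close>
  also have "\<dots> = real (n - 1) * x $ p + (if p < n - 1 then x $ Suc p - x $ p else 0)
      + (if 0 < p then x $ (p - 1) - x $ p else 0)"
    using assms by (auto simp: c_def algebra_simps of_nat_diff)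
  also have "\<dots> = (\<Sum>i<n - 1. x $ p + (if i = p then x $ Suc p - x $ p else 0)
      + (if i = p - 1 \<and> 0 < p then x $ (p - 1) - x $ p else 0))"
    using assms by (cases "0 < p") (auto simp: sum.distrib)
  also have "\<dots> = (\<Sum>i<n - 1. x $ transpose i (Suc i) p)"
    by (intro sum.cong) (auto simp: transpose_def)
  finally show ?thesis .
qed

text \<open>Distinctness of \<open>vs\<close> turns the sum over indices into one over vertices, and
  arcs that stay inside the vertex set reduce it to the neighbours.\<close>

lemma adjacency_matrix_mult_vec:
  assumes "distinct vs" "set vs = pverts G" "k < length vs"
    and "{v. (vs ! k, v) \<in> parcs G} \<subseteq> pverts G"
  shows "(adjacency_matrix G vs *\<^sub>v vec (length vs) (\<lambda>i. f (vs ! i))) $ k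
    = (\<Sum>v \<in> {v. (vs ! k, v) \<in> parcs G}. f v)"
proof -
  have "(adjacency_matrix G vs *\<^sub>v vec (length vs) (\<lambda>i. f (vs ! i))) $ k
      = (\<Sum>i<length vs. if (vs ! k, vs ! i) \<in> parcs G then f (vs ! i) else 0)"
    using assms
    by (auto simp: adjacency_matrix_def scalar_prod_def lessThan_atLeast0 intro!: sum.cong)
  also have "\<dots> = (\<Sum>v \<in> set vs. if (vs ! k, v) \<in> parcs G then f v else 0)"
    by (rule sum.reindex_bij_betw[OF bij_betw_nth[OF assms(1)]]) auto
  also have "\<dots> = (\<Sum>v \<in> {v. (vs ! k, v) \<in> parcs G}. f v)"
    using assms(2,4) by (intro sum.mono_neutral_cong_right) (auto simp flip: assms(2))
  finally show ?thesis .
qed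

text \<open>No cell of the partition is empty, so a nonzero vector has a nonzero lift.\<close>

lemma ex_permutation_with_nth_eq_1:
  assumes "p < n"
  shows "\<exists>u \<in> permutations_of_set {1..n}. position 1 u = p"
proof
  \<comment> \<open>The first block has exactly \<open>p\<close> entries, which puts
    \<open>1\<close> at index \<open>p\<close>.\<close>
  let ?u = "[2..<p + 2] @ [1] @ [p + 2..<n + 1]"
  have u: "distinct ?u" "set ?u = {1..n}" using assms by auto
  then show "?u \<in> permutations_of_set {1..n}" by (auto simp: permutations_of_set_def)
  show "position 1 ?u = p" by (rule position_eqI[OF u(1)])
    (auto simp add: nth_append simp del: upt_Suc append_Cons)
qed

theorem theorem6p2:
  fixes n :: nat and vs :: "nat list list"
  assumes "n \<ge> 2"
    and "distinct vs" and "set vs = pverts (FJ n 1)"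
  shows "spectrum (regularity_matrix n) \<subseteq> spectrum (adjacency_matrix (FJ n 1) vs)"
proof
  fix c assume "c \<in> spectrum (regularity_matrix n)"
  then obtain x where x: "x \<in> carrier_vec n" "x \<noteq> 0\<^sub>v n" "regularity_matrix n *\<^sub>v x = c \<cdot>\<^sub>v x"
    by (auto simp: spectrum_def eigenvalue_def eigenvector_def regularity_matrix_def)
  have vs: "set vs = permutations_of_set {1..n}" using assms(3) by (simp add: FJ_def)
  define f where "f u = x $ position 1 u" for u :: "nat list"
  define y where "y = vec (length vs) (\<lambda>i. f (vs ! i))"
  obtain p where p: "p < n" "x $ p \<noteq> 0"
    using x(1,2) by (metis carrier_vecD eq_vecI index_zero_vec)
  obtain u where "u \<in> set vs" "f u = x $ p"
    using ex_permutation_with_nth_eq_1[OF p(1)] by (auto simp: vs f_def)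
  then obtain k where "k < length vs" "y $ k \<noteq> 0"
    using p(2) by (auto simp: in_set_conv_nth y_def)
  then have "y \<noteq> 0\<^sub>v (length vs)" by auto
  moreover have "adjacency_matrix (FJ n 1) vs *\<^sub>v y = c \<cdot>\<^sub>v y"
  proof (rule eq_vecI)
    fix k assume "k < dim_vec (c \<cdot>\<^sub>v y)"
    then have k: "k < length vs" by (simp add: y_def)
    let ?u = "vs ! k"
    have u_perm: "?u \<in> permutations_of_set {1..n}" using k vs nth_mem by blast
    note u = permutations_of_set_Icc_1D[OF u_perm] and nb = neighbours_FJ_1[OF u_perm]
    have one: "1 \<in> set ?u" using assms(1) u(2) by auto
    \<comment> \<open>The row of a vertex becomes a sum over its swaps, then a sum over moved
      positions of \<open>1\<close>, which is a row of the regularity matrix.\<close>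
    have "(adjacency_matrix (FJ n 1) vs *\<^sub>v y) $ k = (\<Sum>v \<in> {v. (?u, v) \<in> parcs (FJ n 1)}. f v)"
      unfolding y_def using assms(2,3) k by (rule adjacency_matrix_mult_vec) (auto simp: FJ_def)
    also have "\<dots> = (\<Sum>i<n - 1. f (adj_swap i ?u))"
      using u by (simp only: nb sum.reindex[OF inj_on_adj_swap[OF u(1,3)]] o_def)
    also have "\<dots> = (\<Sum>i<n - 1. x $ transpose i (Suc i) (position 1 ?u))"
      using u one by (intro sum.cong) (simp_all add: f_def position_adj_swap)
    also have "\<dots> = (regularity_matrix n *\<^sub>v x) $ position 1 ?u"
      using regularity_matrix_mult_vec[OF assms(1) x(1)] position(1)[OF u(1) one] u(3) by simp
    also have "\<dots> = (c \<cdot>\<^sub>v y) $ k"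
      using position(1)[OF u(1) one] u(3) x k by (simp add: y_def f_def)
    finally show "(adjacency_matrix (FJ n 1) vs *\<^sub>v y) $ k = (c \<cdot>\<^sub>v y) $ k" .
  qed (simp add: y_def adjacency_matrix_def)
  ultimately show "c \<in> spectrum (adjacency_matrix (FJ n 1) vs)"
    by (auto simp: spectrum_def eigenvalue_def eigenvector_def adjacency_matrix_def y_def intro!: exI[of _ y])
qed

end
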